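(* Let $\mathcal{H}$ be a complex Hilbert space and let $A\in\mathcal{B}(\mathcal{H})$ have the Cartesian decomposition $A=B+iC$ with $B,C$ self adjoint. If $f:[0,\infty)\to[0,\infty)$ is an increasing operator convex function, then \[\left\| f\left( \frac{A^{*}A+AA^{*}}{4} \right) \right\|\le \left\| \int_{0}^{1} f\left( (1-t)B^{2}+tC^{2} \right)dt \right\|\le \frac{1}{2}\left\| f(B^{2})+f(C^{2}) \right\|\le f\left( w^{2}(A) \right).\]
   Context: $\mathcal{B}(\mathcal{H})$ is the $C^*$-algebra of bounded linear operators on the complex Hilbert space $\mathcal{H}$; $\|\cdot\|$ is the operator norm; $w(A)=\sup_{\|x\|=1}|\langle Ax,x\rangle|$ is the numerical radius, and $w^2(A)=(w(A))^2$. The Cartesian decomposition of $A$ is the expression $A=B+iC$ with $B,C$ self adjoint. A function $f:J\to\mathbb{R}$ on an interval $J$ is operator convex if it is continuous and $f\left(\frac{X+Y}{2}\right)\le\frac{f(X)+f(Y)}{2}$ (in the positive semi-definite order) for all self adjoint operators $X,Y$ with spectra in $J$. For $X$ self adjoint with spectrum in $J$, $f(X)$ is defined by functional calculus. *)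

theory Defs
  imports
    "HOL-Analysis.Analysis"
    "HOL-Computational_Algebra.Polynomial"
    "HOL-Library.Nonpos_Ints"
begin

section \<open>Complex Hilbert spaces\<close>

class complex_vector = real_vector +
  fixes scaleC :: "complex \<Rightarrow> 'a \<Rightarrow> 'a" (infixr "*\<^sub>C" 75)
  assumes scaleC_add_right: "c *\<^sub>C (x + y) = c *\<^sub>C x + c *\<^sub>C y"
    and scaleC_add_left: "(c + d) *\<^sub>C x = c *\<^sub>C x + d *\<^sub>C x"
    and scaleC_scaleC: "c *\<^sub>C (d *\<^sub>C x) = (c * d) *\<^sub>C x"
    and scaleR_scaleC: "r *\<^sub>R x = complex_of_real r *\<^sub>C x"

text \<open>The inner product \<open>cinner\<close> is linear in the first argument. Its real part is the
  real inner product of the library class, so that the norm is \<open>sqrt (cinner x x)\<close>; positive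
  definiteness is inherited from \<^class>\<open>real_inner\<close>.\<close>

class complex_inner = complex_vector + real_inner +
  fixes cinner :: "'a \<Rightarrow> 'a \<Rightarrow> complex"
  assumes cinner_commute: "cinner x y = cnj (cinner y x)"
    and cinner_add_left: "cinner (x + y) z = cinner x z + cinner y z"
    and cinner_scaleC_left: "cinner (c *\<^sub>C x) y = c * cinner x y"
    and inner_eq_Re_cinner: "inner x y = Re (cinner x y)"

class complex_hilbert = complex_inner + complete_space
begin
subclass banach ..
end

lemma cinner_same: "cinner x x = complex_of_real ((norm x)\<^sup>2)"
  for x :: "'a::complex_inner"
proof -
  have "Im (cinner x x) = 0"
    using arg_cong[OF cinner_commute[of x x], of Im] by simp
  moreover have "Re (cinner x x) = (norm x)\<^sup>2"
    by (simp add: power2_norm_eq_inner inner_eq_Re_cinner)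
  ultimately show ?thesis by (simp add: complex_eq_iff)
qed

instantiation complex :: complex_hilbert
begin
definition scaleC_complex :: "complex \<Rightarrow> complex \<Rightarrow> complex"
  where "scaleC_complex c x = c * x"
definition cinner_complex :: "complex \<Rightarrow> complex \<Rightarrow> complex"
  where "cinner_complex x y = x * cnj y"
instance
  by standard
    (auto simp: scaleC_complex_def cinner_complex_def inner_complex_def algebra_simps
      scaleR_conv_of_real)
end

lemma scaleC_one: "1 *\<^sub>C x = x" for x :: "'a::complex_vector"
  using scaleR_scaleC[of 1 x] by simp

lemma norm_scaleC: "norm (c *\<^sub>C x) = cmod c * norm x" for x :: "'a::complex_inner"
proof -
  have "complex_of_real ((norm (c *\<^sub>C x))\<^sup>2) = c * cnj c * cinner x x"
    unfolding cinner_same[symmetric]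
    by (subst cinner_scaleC_left, subst cinner_commute, subst cinner_scaleC_left)
      (simp add: cinner_same)
  also have "\<dots> = complex_of_real ((cmod c * norm x)\<^sup>2)"
    by (simp add: cinner_same complex_norm_square power_mult_distrib del: of_real_power)
  finally have "(norm (c *\<^sub>C x))\<^sup>2 = (cmod c * norm x)\<^sup>2"
    using of_real_eq_iff by blast
  then show ?thesis by (simp add: power2_eq_iff_nonneg)
qed

lemma bounded_linear_scaleC: "bounded_linear ((*\<^sub>C) c :: 'a::complex_inner \<Rightarrow> 'a)"
proof (rule bounded_linear_intro[where K = "cmod c"])
  show "c *\<^sub>C (x + y) = c *\<^sub>C x + c *\<^sub>C y" for x y :: 'a by (rule scaleC_add_right)
  show "c *\<^sub>C (r *\<^sub>R x) = r *\<^sub>R (c *\<^sub>C x)" for r and x :: 'a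
    by (simp add: scaleR_scaleC scaleC_scaleC mult.commute)
  show "norm (c *\<^sub>C x) \<le> norm x * cmod c" for x :: 'a
    by (simp add: norm_scaleC mult.commute)
qed

lemmas linear_scaleC = bounded_linear.linear[OF bounded_linear_scaleC]

section \<open>The algebra of bounded operators\<close>

text \<open>\<open>'a bop\<close> is the algebra of bounded complex-linear operators on the space \<open>'a\<close>.\<close>

typedef (overloaded) ('a::complex_hilbert) bop =
  "{T :: 'a \<Rightarrow> 'a. bounded_linear T \<and> (\<forall>c x. T (c *\<^sub>C x) = c *\<^sub>C T x)}"
  morphisms bop_apply Bop
  by (rule exI[of _ "\<lambda>x. x"]) (simp add: bounded_linear_ident)

setup_lifting type_definition_bop

declare [[coercion bop_apply]]

lemma bop_eqI: "(\<And>x. bop_apply S x = bop_apply T x) \<Longrightarrow> S = T"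
  by transfer auto

lemma bounded_linear_bop_apply: "bounded_linear (bop_apply T)"
  by transfer auto

instantiation bop :: (complex_hilbert) real_normed_vector
begin

lift_definition norm_bop :: "'a bop \<Rightarrow> real" is onorm .

lift_definition minus_bop :: "'a bop \<Rightarrow> 'a bop \<Rightarrow> 'a bop" is "\<lambda>S T x. S x - T x"
  by (simp add: bounded_linear_sub linear_diff[OF linear_scaleC])

lift_definition uminus_bop :: "'a bop \<Rightarrow> 'a bop" is "\<lambda>T x. - T x"
  by (simp add: bounded_linear_minus linear_neg[OF linear_scaleC])

lift_definition zero_bop :: "'a bop" is "\<lambda>x. 0"
  by (simp add: linear_0[OF linear_scaleC])

lift_definition plus_bop :: "'a bop \<Rightarrow> 'a bop \<Rightarrow> 'a bop" is "\<lambda>S T x. S x + T x"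
  by (auto simp: bounded_linear_add scaleC_add_right)

lift_definition scaleR_bop :: "real \<Rightarrow> 'a bop \<Rightarrow> 'a bop" is "\<lambda>r T x. r *\<^sub>R T x"
  by (simp add: scaleR_scaleC scaleC_scaleC mult.commute
      bounded_linear_compose[OF bounded_linear_scaleC])

definition dist_bop :: "'a bop \<Rightarrow> 'a bop \<Rightarrow> real"
  where "dist_bop S T = norm (S - T)"

definition uniformity_bop :: "('a bop \<times> 'a bop) filter"
  where "uniformity_bop = (INF e\<in>{0 <..}. principal {(S, T). dist S T < e})"

definition open_bop :: "'a bop set \<Rightarrow> bool"
  where "open_bop U = (\<forall>S\<in>U. \<forall>\<^sub>F (S', T) in uniformity. S' = S \<longrightarrow> T \<in> U)"

definition sgn_bop :: "'a bop \<Rightarrow> 'a bop"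
  where "sgn_bop T = inverse (norm T) *\<^sub>R T"

instance
  apply standard
  unfolding dist_bop_def open_bop_def sgn_bop_def uniformity_bop_def
  apply (rule refl | (transfer, force simp: onorm_triangle onorm_scaleR onorm_eq_0 algebra_simps))+
  done

end

instantiation bop :: (complex_hilbert) complex_vector
begin

lift_definition scaleC_bop :: "complex \<Rightarrow> 'a bop \<Rightarrow> 'a bop" is "\<lambda>c T x. c *\<^sub>C T x"
  by (simp add: scaleC_scaleC mult.commute
      bounded_linear_compose[OF bounded_linear_scaleC])

instance
  by standard
    (transfer, simp add: fun_eq_iff scaleC_add_right scaleC_add_left scaleC_scaleC scaleR_scaleC)+

end

text \<open>Multiplication is composition, so that \<open>T ^ n\<close> is the operator power. The class
  \<open>ring_1\<close> is not available because the zero space is not excluded.\<close>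

instantiation bop :: (complex_hilbert) "{real_normed_algebra, monoid_mult}"
begin

lift_definition times_bop :: "'a bop \<Rightarrow> 'a bop \<Rightarrow> 'a bop" is "\<lambda>S T x. S (T x)"
  by (simp add: bounded_linear_compose)

lift_definition one_bop :: "'a bop" is "\<lambda>x. x"
  by (simp add: bounded_linear_ident)

instance
proof
  fix R S T :: "'a bop" and r :: real
  interpret S: bounded_linear "bop_apply S" by (rule bounded_linear_bop_apply)
  show "R * S * T = R * (S * T)" "(R + S) * T = R * T + S * T" "1 * T = T" "T * 1 = T"
    "r *\<^sub>R R * T = r *\<^sub>R (R * T)"
    by (transfer; simp)+
  show "S * (R + T) = S * R + S * T" "S * r *\<^sub>R T = r *\<^sub>R (S * T)"
    by (auto intro!: bop_eqI
        simp: times_bop.rep_eq plus_bop.rep_eq scaleR_bop.rep_eq S.add S.scaleR)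
  show "norm (S * T) \<le> norm S * norm T"
    by transfer (use onorm_compose in \<open>auto simp: o_def\<close>)
qed

end

lemma norm_bop_apply: "norm (bop_apply T x) \<le> norm T * norm x"
  by transfer (auto intro: onorm)

instance bop :: (complex_hilbert) banach
proof
  fix X :: "nat \<Rightarrow> 'a bop"
  assume X: "Cauchy X"
  define b where "b T = Blinfun (bop_apply T)" for T :: "'a bop"
  have b_app: "blinfun_apply (b T) = bop_apply T" for T
    unfolding b_def by (rule bounded_linear_Blinfun_apply[OF bounded_linear_bop_apply])
  have b_norm: "norm (b S - b T) = norm (S - T)" for S T
    by (simp add: norm_blinfun.rep_eq norm_bop.rep_eq minus_blinfun.rep_eq minus_bop.rep_eq b_app)
  have "Cauchy (\<lambda>n. b (X n))"
    using X by (simp add: Cauchy_def dist_norm b_norm)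
  then obtain L where L: "(\<lambda>n. b (X n)) \<longlonglongrightarrow> L"
    using Cauchy_convergent_iff convergent_def by blast
  have L_lim: "(\<lambda>n. bop_apply (X n) x) \<longlonglongrightarrow> blinfun_apply L x" for x
    using blinfun.tendsto[OF L tendsto_const[of x]] by (simp add: b_app)
  have "blinfun_apply L (c *\<^sub>C x) = c *\<^sub>C blinfun_apply L x" for c x
  proof -
    have "(\<lambda>n. c *\<^sub>C bop_apply (X n) x) \<longlonglongrightarrow> c *\<^sub>C blinfun_apply L x"
      by (rule bounded_linear.tendsto[OF bounded_linear_scaleC L_lim])
    moreover have "c *\<^sub>C bop_apply (X n) x = bop_apply (X n) (c *\<^sub>C x)" for n
      using bop_apply[of "X n"] by simp
    ultimately show ?thesis using L_lim[of "c *\<^sub>C x"] LIMSEQ_unique by fastforce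
  qed
  then have "bop_apply (Bop (blinfun_apply L)) = blinfun_apply L"
    by (intro Bop_inverse) (simp add: blinfun.bounded_linear_right)
  then have "b (Bop (blinfun_apply L)) = L"
    by (intro blinfun_eqI) (simp add: b_app)
  then have "norm (X n - Bop (blinfun_apply L)) = norm (b (X n) - L)" for n
    using b_norm[of "X n" "Bop (blinfun_apply L)"] by simp
  moreover have "(\<lambda>n. norm (b (X n) - L)) \<longlonglongrightarrow> 0"
    using L by (simp add: LIM_zero tendsto_norm_zero)
  ultimately have "(\<lambda>n. norm (X n - Bop (blinfun_apply L))) \<longlonglongrightarrow> 0"
    by simp
  then have "X \<longlonglongrightarrow> Bop (blinfun_apply L)"
    by (rule LIM_zero_cancel[OF tendsto_norm_zero_cancel])
  then show "convergent X" by (rule convergentI)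
qed

section \<open>Adjoint, spectrum, order, numerical radius\<close>

definition adj :: "'a::complex_hilbert bop \<Rightarrow> 'a bop"
  where "adj T = (THE S :: 'a bop. \<forall>x y. cinner (T x) y = cinner x (S y))"

definition selfadjoint :: "'a::complex_hilbert bop \<Rightarrow> bool"
  where "selfadjoint T \<longleftrightarrow> adj T = T"

definition spectrum :: "'a::complex_hilbert bop \<Rightarrow> complex set"
  where "spectrum T =
    {z. \<not> (\<exists>S :: 'a bop. S * (T - z *\<^sub>C 1) = 1 \<and> (T - z *\<^sub>C 1) * S = 1)}"

text \<open>Positive semidefinite order. The set \<open>\<real>\<^sub>\<ge>\<^sub>0\<close> consists of the complex
  numbers that are real and nonnegative.\<close>

definition psd_le :: "'a::complex_hilbert bop \<Rightarrow> 'a bop \<Rightarrow> bool" (infix "\<preceq>" 50)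
  where "S \<preceq> T \<longleftrightarrow> (\<forall>x. cinner ((T - S) x) x \<in> \<real>\<^sub>\<ge>\<^sub>0)"

definition numerical_radius :: "'a::complex_hilbert bop \<Rightarrow> real"
  where "numerical_radius T = (SUP x\<in>{x. norm x = 1}. cmod (cinner (T x) x))"

section \<open>Functional calculus and operator convexity\<close>

definition poly_bop :: "real poly \<Rightarrow> 'a::complex_hilbert bop \<Rightarrow> 'a bop"
  where "poly_bop p T = (\<Sum>i\<le>degree p. coeff p i *\<^sub>R T ^ i)"

text \<open>Continuous functional calculus of a self-adjoint operator: \<open>cfc f T\<close> is the norm limit of
  \<open>p\<^sub>n(T)\<close>, where \<open>p\<^sub>n\<close> are real polynomials converging to \<open>f\<close> uniformly on the spectrum of
  \<open>T\<close> (a subset of the real line). It is meant for \<open>f\<close> continuous on the spectrum, and does not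
  depend on the values of \<open>f\<close> elsewhere.\<close>

definition cfc :: "(real \<Rightarrow> real) \<Rightarrow> 'a::complex_hilbert bop \<Rightarrow> 'a bop"
  where "cfc f T = (THE S. \<exists>p :: nat \<Rightarrow> real poly.
    uniform_limit {x. complex_of_real x \<in> spectrum T} (\<lambda>n. poly (p n)) f sequentially \<and>
    (\<lambda>n. poly_bop (p n) T) \<longlonglongrightarrow> S)"

text \<open>Operator convexity is relative to the operators on a given Hilbert space, which is passed
  as a type argument.\<close>

definition operator_convex_on :: "'a::complex_hilbert itself \<Rightarrow> real set \<Rightarrow> (real \<Rightarrow> real) \<Rightarrow> bool"
  where "operator_convex_on _ J f \<longleftrightarrow> continuous_on J f \<and>
    (\<forall>X Y :: 'a bop. selfadjoint X \<and> selfadjoint Y \<and>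
       spectrum X \<subseteq> complex_of_real ` J \<and> spectrum Y \<subseteq> complex_of_real ` J \<longrightarrow>
       cfc f ((1/2) *\<^sub>R (X + Y)) \<preceq> (1/2) *\<^sub>R (cfc f X + cfc f Y))"

end

theory Submission
  imports Defs "HOL-Computational_Algebra.Fundamental_Theorem_Algebra"
begin

text \<open>Since \<open>A\<^sup>*A + AA\<^sup>* = 2 (B\<^sup>2 + C\<^sup>2)\<close>, the first two inequalities are a
  Hermite--Hadamard inequality for the operator convex function \<open>f\<close> at the positive
  operators \<open>X = B\<^sup>2\<close> and \<open>Y = C\<^sup>2\<close>. Put \<open>Z\<^sub>t = (1 - t) X + t Y\<close>. For a fixed vector \<open>x\<close>
  the scalar function \<open>t \<mapsto> \<langle>f(Z\<^sub>t) x, x\<rangle>\<close> is continuous and midpoint convex, so its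
  mean over \<open>[0,1]\<close> lies between its value at \<open>1/2\<close> and the mean of its values at the end points
  (\<open>hermite_hadamard\<close>). As this holds for every \<open>x\<close>, the three operators
  \<open>f((X + Y)/2)\<close>, \<open>\<integral> f(Z\<^sub>t) dt\<close> and \<open>(f(X) + f(Y))/2\<close> increase in the positive semidefinite
  order; the first two are positive because \<open>f \<ge> 0\<close>, and the norm is monotone on positive operators
  (\<open>norm_mono_positive\<close>).

  For the last inequality, \<open>\<langle>Ax, x\<rangle> = \<langle>Bx, x\<rangle> + i \<langle>Cx, x\<rangle>\<close> with both
  inner products on the right real, so \<open>\<parallel>B\<parallel>\<close> and \<open>\<parallel>C\<parallel>\<close> are at most \<open>w(A)\<close>. The norm of \<open>f(B\<^sup>2)\<close> is at most the
  supremum of \<open>f\<close> on \<open>[0, \<parallel>B\<^sup>2\<parallel>]\<close>, which is at most \<open>f(w\<^sup>2(A))\<close> because \<open>f\<close> is increasing;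
  the same holds for \<open>C\<close>.

  Most of the work is the functional calculus behind these arguments. Everything rests on the bound
  \<open>\<parallel>p(T)\<parallel> \<le> sup |p|\<close> over the spectrum, for a real polynomial \<open>p\<close> and a Hermitian \<open>T\<close>
  (\<open>norm_poly_bop_le\<close>). It makes \<open>f(T)\<close> the limit of \<open>p\<^sub>n(T)\<close> for every sequence of
  polynomials converging to \<open>f\<close> uniformly on an interval \<open>[0, M]\<close> that contains the spectrum
  (\<open>cfc_LIMSEQ\<close>), and from this positivity, the norm bound and the norm continuity of
  \<open>T \<mapsto> f(T)\<close> follow.

  Operators are mostly studied through the real inner product, the real part of the complex one: for
  complex-linear operators it determines adjoints, Hermitian operators and the order.\<close>

section \<open>Adjoints and Hermitian operators\<close>

lemmas bop_rep_eqs = plus_bop.rep_eq minus_bop.rep_eq uminus_bop.rep_eq zero_bop.rep_eq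
  scaleR_bop.rep_eq scaleC_bop.rep_eq times_bop.rep_eq one_bop.rep_eq

lemma bop_apply_linear:
  fixes T :: "'a::complex_hilbert bop"
  shows "T (x + y) = T x + T y" "T (x - y) = T x - T y" "T (- x) = - T x" "T 0 = 0"
    "T (r *\<^sub>R x) = r *\<^sub>R T x" "T (c *\<^sub>C x) = c *\<^sub>C T x"
proof -
  interpret bounded_linear "bop_apply T" by (rule bounded_linear_bop_apply)
  show "T (x + y) = T x + T y" "T (x - y) = T x - T y" "T (- x) = - T x" "T 0 = 0"
    "T (r *\<^sub>R x) = r *\<^sub>R T x"
    by (simp_all add: add diff neg zero scaleR)
  show "T (c *\<^sub>C x) = c *\<^sub>C T x" using bop_apply[of T] by simp
qed

lemma Im_cinner: "Im (cinner x y) = - inner (\<i> *\<^sub>C x) y"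
  by (simp add: inner_eq_Re_cinner cinner_scaleC_left)

text \<open>The representing vector minimises \<open>J x = \<parallel>x\<parallel>\<^sup>2 - 2 g x\<close>. By the parallelogram law every minimising
  sequence is Cauchy, and at the minimum the derivative of \<open>J\<close> vanishes in every direction.\<close>

lemma riesz_representation:
  fixes g :: "'a::{real_inner,complete_space} \<Rightarrow> real"
  assumes "bounded_linear g"
  shows "\<exists>y. \<forall>x. g x = inner x y"
proof -
  interpret g: bounded_linear g by fact
  obtain K where K: "\<And>x. \<bar>g x\<bar> \<le> norm x * K" using g.bounded by auto
  define J where "J x = (norm x)\<^sup>2 - 2 * g x" for x
  have J_ge: "- K\<^sup>2 \<le> J x" for x
  proof -
    have "0 \<le> (norm x - K)\<^sup>2" by simp
    with K[of x] show ?thesis unfolding J_def by (simp add: power2_diff)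
  qed
  define m where "m = (INF x. J x)"
  have bdd: "bdd_below (range J)" using J_ge by (auto simp: bdd_below_def)
  have m_le: "m \<le> J x" for x unfolding m_def by (rule cINF_lower[OF bdd]) simp
  have "\<exists>x. J x < m + 1 / Suc n" for n
    using cINF_less_iff[of UNIV J "m + 1 / Suc n"] bdd by (auto simp: m_def)
  then obtain X where X: "\<And>n. J (X n) < m + 1 / Suc n" by metis
  have par: "(norm (x - y))\<^sup>2 \<le> 2 * (J x - m) + 2 * (J y - m)" for x y
  proof -
    have "(norm (x - y))\<^sup>2 = 2 * J x + 2 * J y - 4 * J ((1/2) *\<^sub>R (x + y))"
      unfolding J_def power2_norm_eq_inner
      by (simp add: g.add g.scaleR inner_add inner_diff inner_commute algebra_simps)
    with m_le[of "(1/2) *\<^sub>R (x + y)"] show ?thesis by simp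
  qed
  have "Cauchy X"
  proof (rule CauchyI)
    fix e :: real assume e: "0 < e"
    then have "0 < e\<^sup>2 / 4" by simp
    then obtain N where N: "1 / real (Suc N) < e\<^sup>2 / 4" using nat_approx_posE by blast
    define s where "s = 1 / real (Suc N)"
    have a: "J (X k) - m < s" if "k \<ge> N" for k
    proof -
      have "1 / real (Suc k) \<le> s" using that by (simp add: s_def divide_simps)
      with X[of k] show ?thesis by simp
    qed
    have "norm (X i - X j) < e" if "i \<ge> N" "j \<ge> N" for i j
    proof -
      have "(norm (X i - X j))\<^sup>2 < e\<^sup>2"
      proof -
        have "d < E" if "d \<le> 2 * p + 2 * q" "p < s" "q < s" "s < E / 4" for d p q E :: real
          using that by linarith
        from this[OF par a[OF that(1)] a[OF that(2)]] N show ?thesis by (simp add: s_def)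
      qed
      then show ?thesis using e by (simp add: power_less_imp_less_base)
    qed
    then show "\<exists>M. \<forall>m\<ge>M. \<forall>n\<ge>M. norm (X m - X n) < e" by blast
  qed
  then obtain y where y: "X \<longlonglongrightarrow> y" using Cauchy_convergent_iff convergent_def by blast
  have "(\<lambda>n. J (X n)) \<longlonglongrightarrow> J y"
    unfolding J_def by (intro tendsto_intros g.tendsto y)
  moreover have "(\<lambda>n. m + 1 / real (Suc n)) \<longlonglongrightarrow> m + 0"
    by (intro tendsto_intros LIMSEQ_Suc lim_1_over_n)
  ultimately have Jy: "J y \<le> m"
    using X LIMSEQ_le[of "\<lambda>n. J (X n)" "J y" "\<lambda>n. m + 1 / real (Suc n)" "m + 0"] by (auto intro: less_imp_le)
  have "g x = inner x y" for x
  proof (cases "x = 0")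
    case True then show ?thesis by (simp add: g.zero)
  next
    case False
    define d where "d = inner x y - g x"
    define n where "n = inner x x"
    have n: "n > 0" using False by (simp add: n_def)
    have "J y \<le> J (y + t *\<^sub>R x)" for t using Jy m_le order_trans by blast
    then have "0 \<le> 2 * t * d + t\<^sup>2 * n" for t
      unfolding J_def d_def n_def power2_norm_eq_inner
      by (simp add: g.add g.scaleR inner_add inner_commute algebra_simps power2_eq_square)
    \<comment> \<open>\<open>-d/n\<close> minimises the quadratic polynomial in \<open>t\<close>.\<close>
    from this[of "- d / n"] n have "d\<^sup>2 \<le> 0"
      by (simp add: field_simps power2_eq_square)
    then show ?thesis by (simp add: d_def)
  qed
  then show ?thesis by blast
qed

text \<open>The description operator in the definition of \<open>adj\<close> says something only once an adjoint is
  known to exist. The real Riesz theorem suffices, since replacing \<open>x\<close> by \<open>ix\<close> recovers the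
  imaginary parts.\<close>

lemma adjoint_exists:
  fixes T :: "'a::complex_hilbert bop"
  shows "\<exists>S :: 'a bop. \<forall>x y. cinner (T x) y = cinner x (S y)"
proof -
  have "\<exists>z. \<forall>x. inner (T x) y = inner x z" for y
    by (rule riesz_representation)
      (rule bounded_linear_compose[OF bounded_linear_inner_left bounded_linear_bop_apply])
  then obtain S where S: "\<And>x y. inner (T x) y = inner x (S y)" by metis
  have eqI: "u = v" if "\<And>x. inner x u = inner x v" for u v :: 'a
    using that[of "u - v"] by (metis inner_diff_right inner_eq_zero_iff right_minus_eq)
  have cS: "cinner (T x) y = cinner x (S y)" for x y
    by (rule complex_eqI)
      (simp_all add: Im_cinner inner_eq_Re_cinner[symmetric] S bop_apply_linear(6)[symmetric])
  have bl: "bounded_linear S"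
  proof (rule bounded_linear_intro[where K = "norm T"])
    show "S (x + y) = S x + S y" for x y
      by (rule eqI) (simp add: inner_add_right S[symmetric])
    show "S (r *\<^sub>R x) = r *\<^sub>R S x" for r x
      by (rule eqI) (simp add: S[symmetric])
    show "norm (S y) \<le> norm y * norm T" for y
    proof (cases "S y = 0")
      case False
      have "(norm (S y))\<^sup>2 = inner (T (S y)) y" by (simp add: S power2_norm_eq_inner)
      also have "\<dots> \<le> norm (T (S y)) * norm y" by (rule norm_cauchy_schwarz)
      also have "\<dots> \<le> norm T * norm (S y) * norm y"
        by (intro mult_right_mono norm_bop_apply) simp
      finally show ?thesis using False by (simp add: power2_eq_square mult_ac)
    qed simp
  qed
  have cinnerR: "cinner x (c *\<^sub>C y) = cnj c * cinner x y" for c and x y :: 'a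
    by (metis cinner_commute cinner_scaleC_left complex_cnj_mult)
  have "S (c *\<^sub>C x) = c *\<^sub>C S x" for c x
    by (rule eqI) (simp add: inner_eq_Re_cinner cS[symmetric] cinnerR)
  with bl have "bop_apply (Bop S) = S" by (intro Bop_inverse) simp
  with cS show ?thesis by metis
qed

lemma adj_eqI:
  fixes T S :: "'a::complex_hilbert bop"
  assumes "\<And>x y. inner (T x) y = inner x (S y)"
  shows "adj T = S"
  unfolding adj_def
proof (rule the_equality)
  show "\<forall>x y. cinner (T x) y = cinner x (S y)"
    by (intro allI complex_eqI)
      (simp_all add: Im_cinner inner_eq_Re_cinner[symmetric] assms bop_apply_linear(6)[symmetric])
  fix R :: "'a bop" assume R: "\<forall>x y. cinner (T x) y = cinner x (R y)"
  show "R = S"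
  proof (rule bop_eqI)
    fix y
    have "inner x (R y) = inner x (S y)" for x
      using R assms[of x y] by (simp add: inner_eq_Re_cinner)
    then have "inner x (R y - S y) = 0" for x by (simp add: inner_diff_right)
    then show "R y = S y" using inner_eq_zero_iff right_minus_eq by blast
  qed
qed

lemma inner_adj:
  fixes T :: "'a::complex_hilbert bop"
  shows "inner (T x) y = inner x (adj T y)"
proof -
  obtain S :: "'a bop" where S: "\<forall>x y. cinner (T x) y = cinner x (S y)"
    using adjoint_exists by blast
  then have "adj T = S" by (intro adj_eqI) (simp add: inner_eq_Re_cinner)
  with S show ?thesis by (simp add: inner_eq_Re_cinner)
qed

definition hermitian :: "'a::complex_hilbert bop \<Rightarrow> bool"
  where "hermitian T \<longleftrightarrow> (\<forall>x y. inner (T x) y = inner x (T y))"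

lemma selfadjoint_iff_hermitian: "selfadjoint T \<longleftrightarrow> hermitian T"
  unfolding selfadjoint_def hermitian_def using adj_eqI inner_adj by metis

lemma hermitianD: "hermitian T \<Longrightarrow> inner (T x) y = inner x (T y)"
  by (simp add: hermitian_def)

lemma hermitian_intros:
  "hermitian 1" "hermitian 0"
  "hermitian S \<Longrightarrow> hermitian T \<Longrightarrow> hermitian (S + T)"
  "hermitian S \<Longrightarrow> hermitian T \<Longrightarrow> hermitian (S - T)"
  "hermitian T \<Longrightarrow> hermitian (r *\<^sub>R T)"
  by (simp_all add: hermitian_def bop_rep_eqs inner_add inner_diff)

lemma hermitian_power:
  assumes "hermitian T" shows "hermitian (T ^ n)"
proof (induction n)
  case (Suc n)
  have "T * T ^ n = T ^ n * T" by (simp add: power_commutes)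
  then show ?case using assms Suc
    by (simp add: hermitian_def times_bop.rep_eq) (metis times_bop.rep_eq)
qed (simp add: hermitian_intros)

lemma norm_bop_le:
  fixes T :: "'a::complex_hilbert bop"
  assumes "0 \<le> K" "\<And>x. norm (T x) \<le> K * norm x"
  shows "norm T \<le> K"
  unfolding norm_bop.rep_eq by (rule onorm_bound) (rule assms)+

text \<open>Polarisation: \<open>4 \<langle>Tx, y\<rangle>\<close> is the difference of the values of the quadratic form at \<open>x + y\<close> and
  \<open>x - y\<close>, and the parallelogram law bounds it by \<open>2K (\<parallel>x\<parallel>\<^sup>2 + \<parallel>y\<parallel>\<^sup>2)\<close>. The best \<open>y\<close> is the multiple of
  \<open>Tx\<close> that has the length of \<open>x\<close>.\<close>

lemma hermitian_norm_le:
  fixes T :: "'a::complex_hilbert bop"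
  assumes T: "hermitian T" and K0: "0 \<le> K" and K: "\<And>x. \<bar>inner (T x) x\<bar> \<le> K * (norm x)\<^sup>2"
  shows "norm T \<le> K"
proof (rule norm_bop_le[OF K0])
  fix x
  show "norm (T x) \<le> K * norm x"
  proof (cases "T x = 0 \<or> x = 0")
    case True
    with K0 show ?thesis by (auto simp: bop_apply_linear)
  next
    case False
    define y where "y = (norm x / norm (T x)) *\<^sub>R T x"
    have ny: "norm y = norm x" using False by (simp add: y_def)
    have ixy: "inner (T x) y = norm x * norm (T x)"
      using False by (simp add: y_def power2_norm_eq_inner[symmetric] power2_eq_square)
    have "4 * inner (T x) y = inner (T (x + y)) (x + y) - inner (T (x - y)) (x - y)"
      using hermitianD[OF T, of x y]
      by (simp add: bop_apply_linear inner_add inner_diff inner_commute algebra_simps)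
    also have "\<dots> \<le> K * (norm (x + y))\<^sup>2 + K * (norm (x - y))\<^sup>2"
      using K[of "x + y"] K[of "x - y"] by linarith
    also have "\<dots> = 2 * K * ((norm x)\<^sup>2 + (norm y)\<^sup>2)"
      by (simp add: power2_norm_eq_inner inner_add inner_diff inner_commute algebra_simps)
    finally have "norm x * norm (T x) \<le> norm x * (K * norm x)"
      by (simp add: ny ixy power2_eq_square algebra_simps)
    then show ?thesis using False by simp
  qed
qed

section \<open>Positive operators and the real spectrum\<close>

definition positive :: "'a::complex_hilbert bop \<Rightarrow> bool"
  where "positive T \<longleftrightarrow> hermitian T \<and> (\<forall>x. 0 \<le> inner (T x) x)"

lemma inner_bop_le:
  fixes T :: "'a::complex_hilbert bop"
  shows "inner (bop_apply T x) x \<le> norm T * (norm x)\<^sup>2"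
proof -
  have "inner (T x) x \<le> norm (T x) * norm x" by (rule norm_cauchy_schwarz)
  also have "\<dots> \<le> (norm T * norm x) * norm x" by (intro mult_right_mono norm_bop_apply) simp
  finally show ?thesis by (simp add: power2_eq_square mult_ac)
qed

lemma norm_mono_positive:
  assumes "positive S" "\<And>x. inner (bop_apply S x) x \<le> inner (bop_apply T x) x"
  shows "norm S \<le> norm T"
proof (rule hermitian_norm_le)
  show "hermitian S" using assms(1) by (simp add: positive_def)
  show "0 \<le> norm T" by simp
  show "\<bar>inner (S x) x\<bar> \<le> norm T * (norm x)\<^sup>2" for x
    using assms(1) assms(2)[of x] inner_bop_le[of T x] by (simp add: positive_def)
qed

lemma positive_sq:
  assumes "hermitian T" shows "positive (T\<^sup>2)"
proof -
  have "0 \<le> inner ((T\<^sup>2) x) x" for x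
    using hermitianD[OF assms, of "T x" x] by (simp add: power2_eq_square times_bop.rep_eq)
  then show ?thesis using hermitian_power[OF assms, of 2] by (simp add: positive_def)
qed

lemma positive_add: "positive S \<Longrightarrow> positive T \<Longrightarrow> positive (S + T)"
  by (simp add: positive_def hermitian_intros bop_rep_eqs inner_add)

lemma positive_scaleR: "positive T \<Longrightarrow> 0 \<le> r \<Longrightarrow> positive (r *\<^sub>R T)"
  by (simp add: positive_def hermitian_intros bop_rep_eqs)

definition invertible_bop :: "'a::complex_hilbert bop \<Rightarrow> bool"
  where "invertible_bop T \<longleftrightarrow> (\<exists>S. S * T = 1 \<and> T * S = 1)"

lemma spectrum_iff: "z \<in> spectrum T \<longleftrightarrow> \<not> invertible_bop (T - z *\<^sub>C 1)"
  by (simp add: spectrum_def invertible_bop_def)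

lemma invertible_bop_scaleR:
  assumes "invertible_bop T" "r \<noteq> 0" shows "invertible_bop (r *\<^sub>R T)"
proof -
  obtain S where "S * T = 1" "T * S = 1" using assms by (auto simp: invertible_bop_def)
  then have "(inverse r *\<^sub>R S) * (r *\<^sub>R T) = 1" "(r *\<^sub>R T) * (inverse r *\<^sub>R S) = 1"
    using assms by simp_all
  then show ?thesis unfolding invertible_bop_def by blast
qed

lemma neumann_series:
  fixes D :: "'a::complex_hilbert bop"
  assumes "norm D < 1"
  shows "invertible_bop (1 - D)"
proof -
  have n1: "norm (1::'a bop) \<le> 1" by (rule norm_bop_le) (simp_all add: one_bop.rep_eq)
  have "norm (D ^ n) \<le> norm D ^ n" for n
  proof (induction n)
    case (Suc n)
    have "norm (D ^ Suc n) \<le> norm D * norm (D ^ n)" by (simp add: norm_mult_ineq)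
    also have "\<dots> \<le> norm D * norm D ^ n" by (intro mult_left_mono Suc) simp
    finally show ?case by simp
  qed (simp add: n1)
  then have sum: "summable (\<lambda>n. D ^ n)"
    using assms by (intro summable_comparison_test'[OF summable_geometric[of "norm D"]]) auto
  define R where "R = (\<Sum>n. D ^ n)"
  have s: "(\<lambda>n. D ^ n) sums R" using sum by (simp add: R_def summable_sums)
  have "(\<lambda>n. D ^ Suc n) sums (R - 1)"
    using s sums_Suc_iff[of "\<lambda>n. D ^ n" "R - 1"] by simp
  moreover have "(\<lambda>n. D ^ Suc n) sums (D * R)"
    using sums_mult[OF s, of D] by simp
  moreover have "(\<lambda>n. D ^ Suc n) sums (R * D)"
    using sums_mult2[OF s, of D] by (simp add: power_commutes)
  ultimately have "D * R = R - 1" "R * D = R - 1" using sums_unique2 by blast+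
  then have "R * (1 - D) = 1" "(1 - D) * R = 1" by (simp_all add: algebra_simps)
  then show ?thesis unfolding invertible_bop_def by blast
qed

text \<open>For \<open>N\<close> large, \<open>D = 1 - S/N\<close> is positive with quadratic form at most \<open>1 - c/N\<close>, hence of norm
  below 1, and \<open>S = N (1 - D)\<close> is inverted by the Neumann series. This is the only source of
  inverses in the study of spectra below.\<close>

lemma invertible_of_lower_bound:
  fixes S :: "'a::complex_hilbert bop"
  assumes S: "hermitian S" and c: "c > 0" "\<And>x. c * (norm x)\<^sup>2 \<le> inner (S x) x"
  shows "invertible_bop S"
proof -
  define N where "N = norm S + c"
  have N: "N > 0" "norm S \<le> N" "c \<le> N" using c by (simp_all add: N_def add_nonneg_pos)
  define D where "D = 1 - inverse N *\<^sub>R S"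
  have "norm D \<le> 1 - c / N"
  proof (rule hermitian_norm_le)
    show "hermitian D" unfolding D_def by (intro hermitian_intros S)
    show "0 \<le> 1 - c / N" using N by simp
    fix x
    have e: "inner (D x) x = (norm x)\<^sup>2 - inner (S x) x / N"
      by (simp add: D_def bop_rep_eqs inner_diff power2_norm_eq_inner divide_inverse_commute)
    have "inner (S x) x \<le> N * (norm x)\<^sup>2"
      using inner_bop_le[of S x] mult_right_mono[OF N(2), of "(norm x)\<^sup>2"] by simp
    then have "0 \<le> inner (D x) x" using N(1) by (simp add: e field_simps)
    moreover have "inner (D x) x \<le> (1 - c / N) * (norm x)\<^sup>2"
      using c(2)[of x] N(1) by (simp add: e field_simps)
    ultimately show "\<bar>inner (D x) x\<bar> \<le> (1 - c / N) * (norm x)\<^sup>2" by simp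
  qed
  also have "\<dots> < 1" using c N by simp
  finally have "invertible_bop (1 - D)" by (rule neumann_series)
  then have "invertible_bop (N *\<^sub>R (1 - D))" using N by (intro invertible_bop_scaleR) auto
  moreover have "N *\<^sub>R (1 - D) = S" using N by (simp add: D_def)
  ultimately show ?thesis by simp
qed

lemma bop_scaleC_mult:
  fixes S T :: "'a::complex_hilbert bop"
  shows "(c *\<^sub>C S) * T = c *\<^sub>C (S * T)" "S * (c *\<^sub>C T) = c *\<^sub>C (S * T)"
proof -
  show "(c *\<^sub>C S) * T = c *\<^sub>C (S * T)"
    by (rule bop_eqI) (simp add: bop_rep_eqs)
  show "S * (c *\<^sub>C T) = c *\<^sub>C (S * T)"
    by (rule bop_eqI) (simp add: bop_rep_eqs bop_apply_linear)
qed

lemma scaleC_zero_left: "0 *\<^sub>C x = 0" for x :: "'a::complex_vector"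
  using scaleR_scaleC[of 0 x] by simp

lemma scaleC_minus_left: "(- c) *\<^sub>C x = - (c *\<^sub>C x)" for x :: "'a::complex_vector"
proof -
  have "(- c) *\<^sub>C x + c *\<^sub>C x = (- c + c) *\<^sub>C x" by (simp only: scaleC_add_left)
  also have "\<dots> = 0" by (simp add: scaleC_zero_left)
  finally show ?thesis by (simp add: eq_neg_iff_add_eq_0)
qed

lemma scaleC_diff_left: "(c - d) *\<^sub>C x = c *\<^sub>C x - d *\<^sub>C x" for x :: "'a::complex_vector"
  using scaleC_add_left[of c "- d" x] by (simp add: scaleC_minus_left)

lemma scaleC_diff_right: "c *\<^sub>C (x - y) = c *\<^sub>C x - c *\<^sub>C y" for x y :: "'a::complex_vector"
  using scaleC_add_right[of c "x - y" y] by (simp add: eq_diff_eq)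

text \<open>For \<open>z = a + ib\<close> with \<open>b \<noteq> 0\<close>, the operators \<open>T - z\<close> and \<open>T - cnj z\<close> commute and their product
  \<open>(T - a)\<^sup>2 + b\<^sup>2\<close> is bounded below by \<open>b\<^sup>2\<close>, hence invertible.\<close>

lemma spectrum_real:
  fixes T :: "'a::complex_hilbert bop"
  assumes T: "hermitian T" and z: "z \<in> spectrum T"
  shows "Im z = 0"
proof (rule ccontr)
  assume im: "Im z \<noteq> 0"
  define U where "U = T - Re z *\<^sub>R 1"
  define V where "V = T - z *\<^sub>C 1"
  define W where "W = T - cnj z *\<^sub>C 1"
  define P where "P = U\<^sup>2 + (Im z)\<^sup>2 *\<^sub>R 1"
  have U: "hermitian U" unfolding U_def by (intro hermitian_intros T)
  have "invertible_bop P"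
  proof (rule invertible_of_lower_bound)
    show "hermitian P" unfolding P_def by (intro hermitian_intros hermitian_power U)
    show "(Im z)\<^sup>2 > 0" using im by simp
    show "(Im z)\<^sup>2 * (norm x)\<^sup>2 \<le> inner (P x) x" for x
      using positive_sq[OF U]
      by (simp add: P_def bop_rep_eqs inner_add positive_def power2_norm_eq_inner)
  qed
  then obtain R where R: "R * P = 1" "P * R = 1" by (auto simp: invertible_bop_def)
  have VU: "V = U - (\<i> * Im z) *\<^sub>C 1" "W = U + (\<i> * Im z) *\<^sub>C 1"
    unfolding U_def V_def W_def
    by (subst (1) complex_eq[of z], simp add: scaleC_add_left scaleR_scaleC)
      (subst (1) complex_eq[of "cnj z"], simp add: scaleC_diff_left scaleR_scaleC)
  have "V * W = P" "W * V = P"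
    unfolding VU P_def
    by (simp_all add: algebra_simps bop_scaleC_mult scaleC_scaleC scaleR_scaleC power2_eq_square
        scaleC_minus_left scaleC_add_right scaleC_diff_right)
  then have "V * (W * R) = 1" "(R * W) * V = 1" using R by (simp_all add: mult.assoc[symmetric]) (simp add: mult.assoc)
  then have "(R * W) = W * R" by (metis mult.assoc mult.left_neutral mult.right_neutral)
  then have "invertible_bop V" unfolding invertible_bop_def
    using \<open>V * (W * R) = 1\<close> \<open>(R * W) * V = 1\<close> by metis
  with z show False by (simp add: spectrum_iff V_def)
qed

lemma spectrum_positive:
  fixes T :: "'a::complex_hilbert bop"
  assumes T: "positive T" and z: "z \<in> spectrum T"
  shows "z = of_real (Re z)" "0 \<le> Re z" "Re z \<le> norm T"
proof -
  have h: "hermitian T" using T by (simp add: positive_def)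
  have "Im z = 0" using spectrum_real[OF h z] .
  then show zr: "z = of_real (Re z)" by (simp add: complex_eq_iff)
  then have ni: "\<not> invertible_bop (T - Re z *\<^sub>R 1)"
    using z by (metis spectrum_iff scaleR_scaleC)
  show "0 \<le> Re z"
  proof (rule ccontr)
    assume "\<not> 0 \<le> Re z"
    then have "invertible_bop (T - Re z *\<^sub>R 1)"
      using T by (intro invertible_of_lower_bound[where c = "- Re z"] hermitian_intros h)
        (auto simp: positive_def bop_rep_eqs inner_diff power2_norm_eq_inner)
    with ni show False by simp
  qed
  show "Re z \<le> norm T"
  proof (rule ccontr)
    assume "\<not> Re z \<le> norm T"
    then have "invertible_bop (Re z *\<^sub>R 1 - T)"
      using inner_bop_le[of T]
      by (intro invertible_of_lower_bound[where c = "Re z - norm T"] hermitian_intros h)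
        (auto simp: bop_rep_eqs inner_diff power2_norm_eq_inner algebra_simps)
    then have "invertible_bop ((-1) *\<^sub>R (Re z *\<^sub>R 1 - T))" by (rule invertible_bop_scaleR) simp
    with ni show False by simp
  qed
qed

section \<open>Polynomials of a Hermitian operator\<close>

text \<open>Polynomials with complex coefficients are needed so that \<open>p(T)\<close> can be split into
  linear factors \<open>T - z\<close>.\<close>

definition cpoly_bop :: "complex poly \<Rightarrow> 'a::complex_hilbert bop \<Rightarrow> 'a bop"
  where "cpoly_bop p T = (\<Sum>i\<le>degree p. coeff p i *\<^sub>C T ^ i)"

lemma cpoly_bop_upto:
  assumes "degree p \<le> n"
  shows "cpoly_bop p T = (\<Sum>i\<le>n. coeff p i *\<^sub>C T ^ i)"
  unfolding cpoly_bop_def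
  by (rule sum.mono_neutral_left) (use assms in \<open>auto simp: coeff_eq_0 scaleC_zero_left\<close>)

lemma cpoly_bop_0: "cpoly_bop 0 T = 0"
  by (simp add: cpoly_bop_def scaleC_zero_left)

lemma cpoly_bop_pCons: "cpoly_bop (pCons a p) T = a *\<^sub>C 1 + T * cpoly_bop p T"
proof -
  have "cpoly_bop (pCons a p) T = (\<Sum>i\<le>Suc (degree p). coeff (pCons a p) i *\<^sub>C T ^ i)"
    by (rule cpoly_bop_upto) (rule degree_pCons_le)
  also have "\<dots> = a *\<^sub>C 1 + T * cpoly_bop p T"
    unfolding sum.atMost_Suc_shift cpoly_bop_def by (simp add: sum_distrib_left bop_scaleC_mult)
  finally show ?thesis .
qed

lemma cpoly_bop_add: "cpoly_bop (p + q) T = cpoly_bop p T + cpoly_bop q T"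
  using cpoly_bop_upto[of p "max (degree p) (degree q)" T]
    cpoly_bop_upto[of q "max (degree p) (degree q)" T]
    cpoly_bop_upto[of "p + q" "max (degree p) (degree q)" T]
  by (simp add: degree_add_le_max sum.distrib scaleC_add_left)

lemma cpoly_bop_smult: "cpoly_bop (smult a p) T = a *\<^sub>C cpoly_bop p T"
proof (induction p)
  case 0
  have "a *\<^sub>C (0 :: 'a bop) = 0" by (rule bop_eqI) (metis bop_apply_linear(4,6) scaleC_bop.rep_eq zero_bop.rep_eq)
  then show ?case by (simp add: cpoly_bop_0)
next
  case (pCons b p)
  then show ?case by (simp add: cpoly_bop_pCons scaleC_add_right scaleC_scaleC bop_scaleC_mult)
qed

lemma cpoly_bop_mult: "cpoly_bop (p * q) T = cpoly_bop p T * cpoly_bop q T"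
proof (induction p)
  case (pCons a p)
  then show ?case
    by (simp add: cpoly_bop_pCons cpoly_bop_add cpoly_bop_smult distrib_right bop_scaleC_mult
        scaleC_zero_left mult.assoc)
qed (simp add: cpoly_bop_0)

abbreviation complex_poly :: "real poly \<Rightarrow> complex poly"
  where "complex_poly \<equiv> map_poly complex_of_real"

lemma complex_poly_ring:
  "complex_poly (p - q) = complex_poly p - complex_poly q"
  "complex_poly (p * q) = complex_poly p * complex_poly q"
  by (rule poly_eqI, simp add: coeff_map_poly coeff_mult)+

lemma poly_complex_poly: "poly (complex_poly p) (of_real x) = of_real (poly p x)"
  by (induction p) (simp_all add: map_poly_pCons)

lemma poly_bop_conv: "poly_bop p T = cpoly_bop (complex_poly p) T"
  by (simp add: poly_bop_def cpoly_bop_def coeff_map_poly scaleR_scaleC degree_map_poly)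

lemma poly_bop_mult: "poly_bop (p * q) T = poly_bop p T * poly_bop q T"
  by (simp add: poly_bop_conv complex_poly_ring cpoly_bop_mult)

lemma poly_bop_diff: "poly_bop (p - q) T = poly_bop p T - poly_bop q T"
  using cpoly_bop_add[of "complex_poly (p - q)" "complex_poly q" T]
  by (simp add: poly_bop_conv complex_poly_ring)

lemma poly_bop_const: "poly_bop [:c:] T = c *\<^sub>R 1"
  by (simp add: poly_bop_def)

lemma hermitian_poly_bop:
  assumes "hermitian T" shows "hermitian (poly_bop p T)"
proof -
  have "hermitian (\<Sum>i\<le>n. coeff p i *\<^sub>R T ^ i)" for n
    by (induction n)
      (auto simp del: power_Suc intro!: hermitian_intros hermitian_power assms)
  then show ?thesis by (simp add: poly_bop_def)
qed

text \<open>For normal operators this is equivalent to invertibility. It is the convenient notion here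
  because products of operators that are bounded below are again so, without any discussion of ranges.\<close>

definition bounded_below :: "'a::complex_hilbert bop \<Rightarrow> bool"
  where "bounded_below T \<longleftrightarrow> (\<exists>c>0. \<forall>x. c * norm x \<le> norm (bop_apply T x))"

lemma invertible_bounded_below:
  assumes "invertible_bop T" shows "bounded_below T"
proof -
  obtain S where S: "S * T = 1" using assms by (auto simp: invertible_bop_def)
  have pos: "0 < norm S + 1" by (simp add: add_nonneg_pos)
  have "1 / (norm S + 1) * norm x \<le> norm (bop_apply T x)" for x
  proof -
    have "norm x = norm (S (T x))" using S by (metis times_bop.rep_eq one_bop.rep_eq)
    also have "\<dots> \<le> norm S * norm (bop_apply T x)" by (rule norm_bop_apply)
    also have "\<dots> \<le> (norm S + 1) * norm (bop_apply T x)" by (intro mult_right_mono) auto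
    finally show ?thesis using pos by (simp add: pos_divide_le_eq mult.commute)
  qed
  moreover have "0 < 1 / (norm S + 1)" using pos by simp
  ultimately show ?thesis unfolding bounded_below_def by blast
qed

lemma bounded_below_mult:
  assumes "bounded_below S" "bounded_below T" shows "bounded_below (S * T)"
proof -
  obtain c d where c: "c > 0" "\<And>x. c * norm x \<le> norm (bop_apply S x)"
    and d: "d > 0" "\<And>x. d * norm x \<le> norm (bop_apply T x)"
    using assms by (auto simp: bounded_below_def)
  have "c * d * norm x \<le> norm (bop_apply (S * T) x)" for x
  proof -
    have "c * (d * norm x) \<le> c * norm (bop_apply T x)" using c(1) d(2) by (intro mult_left_mono) auto
    also have "\<dots> \<le> norm (bop_apply S (bop_apply T x))" by (rule c(2))
    finally show ?thesis by (simp add: times_bop.rep_eq mult.assoc)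
  qed
  then show ?thesis using c(1) d(1) unfolding bounded_below_def by (meson mult_pos_pos)
qed

text \<open>The half of the spectral mapping theorem that is used: if \<open>p(T)\<close> is degenerate, then so is one of
  its linear factors.\<close>

lemma bounded_below_cpoly_bop:
  assumes "p \<noteq> 0" "\<And>z. poly p z = 0 \<Longrightarrow> bounded_below (T - z *\<^sub>C 1)"
  shows "bounded_below (cpoly_bop p T)"
  using assms
proof (induction "degree p" arbitrary: p rule: less_induct)
  case less
  show ?case
  proof (cases "degree p = 0")
    case True
    then obtain a where p: "p = [:a:]" by (rule degree_eq_zeroE)
    then have "norm (bop_apply (cpoly_bop p T) x) = cmod a * norm x" for x
      by (simp add: cpoly_bop_pCons cpoly_bop_0 bop_rep_eqs norm_scaleC)
    moreover have "cmod a > 0" using less.prems p by simp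
    ultimately show ?thesis unfolding bounded_below_def by (metis order_refl)
  next
    case False
    then have "\<not> constant (poly p)" by (simp add: constant_degree)
    then obtain z where z: "poly p z = 0" using fundamental_theorem_of_algebra by blast
    then obtain q where q: "p = [:-z, 1:] * q" by (auto simp: poly_eq_0_iff_dvd)
    then have q0: "q \<noteq> 0" using less.prems by auto
    have "degree q < degree p" using q0 by (simp add: q degree_mult_eq del: mult_pCons_left)
    then have "bounded_below (cpoly_bop q T)"
      using less.hyps less.prems(2) q0 by (simp add: q del: mult_pCons_left)
    moreover have "cpoly_bop [:-z, 1:] T = T - z *\<^sub>C 1"
      by (simp add: cpoly_bop_pCons cpoly_bop_0 scaleC_minus_left scaleC_one)
    ultimately show ?thesis
      using less.prems(2)[OF z] unfolding q cpoly_bop_mult by (simp add: bounded_below_mult)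
  qed
qed

text \<open>The number \<open>l = \<parallel>S\<parallel>\<^sup>2\<close> is an approximate eigenvalue of \<open>S\<^sup>2\<close>. Expanding the square and using
  \<open>\<parallel>S\<^sup>2x\<parallel>\<^sup>2 \<le> l \<parallel>Sx\<parallel>\<^sup>2\<close> gives \<open>\<parallel>S\<^sup>2x - lx\<parallel>\<^sup>2 \<le> l (l \<parallel>x\<parallel>\<^sup>2 - \<parallel>Sx\<parallel>\<^sup>2)\<close>, so a lower bound
  \<open>c \<parallel>x\<parallel>\<close> for the left-hand norm would improve the operator norm of \<open>S\<close> to \<open>sqrt (l - c\<^sup>2/l)\<close>.
  On the zero space every operator is bounded below, hence the assumption \<open>1 \<noteq> 0\<close>.\<close>

lemma norm_sq_not_bounded_below:
  fixes S :: "'a::complex_hilbert bop"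
  assumes S: "hermitian S" and nt: "(1 :: 'a bop) \<noteq> 0"
  shows "\<not> bounded_below (S * S - (norm S)\<^sup>2 *\<^sub>R 1)"
proof
  assume "bounded_below (S * S - (norm S)\<^sup>2 *\<^sub>R 1)"
  then obtain c where c: "c > 0"
    "\<And>x. c * norm x \<le> norm (bop_apply (S * S - (norm S)\<^sup>2 *\<^sub>R 1) x)"
    unfolding bounded_below_def by blast
  define l where "l = (norm S)\<^sup>2"
  have l0: "0 \<le> l" by (simp add: l_def)
  have key: "c\<^sup>2 * (norm x)\<^sup>2 \<le> l * (l * (norm x)\<^sup>2 - (norm (bop_apply S x))\<^sup>2)" for x
  proof -
    have "(norm (S (S x)))\<^sup>2 \<le> (norm S * norm (bop_apply S x))\<^sup>2"
      by (intro power_mono norm_bop_apply) simp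
    then have SS: "(norm (S (S x)))\<^sup>2 \<le> l * (norm (bop_apply S x))\<^sup>2"
      by (simp add: l_def power_mult_distrib)
    have "(c * norm x)\<^sup>2 \<le> (norm (S (S x) - l *\<^sub>R x))\<^sup>2"
      using c(2)[of x] c(1) by (intro power_mono) (simp_all add: bop_rep_eqs l_def)
    also have "\<dots> = (norm (S (S x)))\<^sup>2 - 2 * l * (norm (bop_apply S x))\<^sup>2 + l\<^sup>2 * (norm x)\<^sup>2"
      using hermitianD[OF S, of "S x" x] unfolding power2_norm_eq_inner
      by (simp add: inner_diff inner_commute algebra_simps power2_eq_square)
    finally show ?thesis using SS by (simp add: power_mult_distrib power2_eq_square algebra_simps)
  qed
  obtain x0 :: 'a where x0: "x0 \<noteq> 0"
    using nt by (metis bop_eqI one_bop.rep_eq zero_bop.rep_eq)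
  have "0 < c\<^sup>2 * (norm x0)\<^sup>2" using c(1) x0 by simp
  then have "l \<noteq> 0" using key[of x0] by auto
  with l0 have l: "l > 0" by simp
  have Sx: "(norm (bop_apply S x))\<^sup>2 \<le> (l - c\<^sup>2 / l) * (norm x)\<^sup>2" for x
    using key[of x] l by (simp add: field_simps power2_eq_square)
  have "0 \<le> (l - c\<^sup>2 / l) * (norm x0)\<^sup>2"
    using Sx[of x0] by (meson order_trans zero_le_power2)
  then have k0: "0 \<le> l - c\<^sup>2 / l" using x0 by (simp add: zero_le_mult_iff)
  have "norm S \<le> sqrt (l - c\<^sup>2 / l)"
  proof (rule norm_bop_le)
    show "0 \<le> sqrt (l - c\<^sup>2 / l)" using k0 by simp
    show "norm (bop_apply S x) \<le> sqrt (l - c\<^sup>2 / l) * norm x" for x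
      using real_le_rsqrt[OF Sx[of x]] by (simp add: real_sqrt_mult)
  qed
  then have "l \<le> l - c\<^sup>2 / l" using k0 by (simp add: l_def real_le_rsqrt sqrt_ge_absD)
  then show False using c(1) l by (simp add: field_simps)
qed

text \<open>With \<open>P = p(T)\<close>, the operator \<open>P\<^sup>2 - \<parallel>P\<parallel>\<^sup>2\<close> is not bounded below and is the value at \<open>T\<close> of the
  polynomial \<open>p\<^sup>2 - \<parallel>P\<parallel>\<^sup>2\<close>, one of whose roots must therefore lie in the spectrum. If this polynomial
  vanishes identically, there is nothing to factorise.\<close>

lemma norm_poly_bop_attained_nondegenerate:
  fixes T :: "'a::complex_hilbert bop"
  assumes T: "hermitian T" and nt: "(1 :: 'a bop) \<noteq> 0"
    and q: "p * p - [:(norm (poly_bop p T))\<^sup>2:] \<noteq> 0"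
  shows "\<exists>x. complex_of_real x \<in> spectrum T \<and> \<bar>poly p x\<bar> = norm (poly_bop p T)"
proof -
  define P where "P = poly_bop p T"
  define r where "r = p * p - [:(norm P)\<^sup>2:]"
  have "poly_bop r T = P * P - (norm P)\<^sup>2 *\<^sub>R 1"
    by (simp add: r_def poly_bop_diff poly_bop_mult poly_bop_const P_def)
  then have "\<not> bounded_below (cpoly_bop (complex_poly r) T)"
    using norm_sq_not_bounded_below[OF hermitian_poly_bop[OF T] nt, of p]
    by (simp add: poly_bop_conv[symmetric] P_def)
  moreover have "complex_poly r \<noteq> 0"
    using q by (simp add: r_def P_def map_poly_eq_0_iff)
  ultimately obtain z where z: "poly (complex_poly r) z = 0" "\<not> bounded_below (T - z *\<^sub>C 1)"
    using bounded_below_cpoly_bop by blast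
  then have zs: "z \<in> spectrum T" using invertible_bounded_below by (auto simp: spectrum_iff)
  have zr: "z = of_real (Re z)" using spectrum_real[OF T zs] by (simp add: complex_eq_iff)
  have "poly r (Re z) = 0" using z(1) zr by (metis poly_complex_poly of_real_eq_0_iff)
  then have "(poly p (Re z))\<^sup>2 = (norm P)\<^sup>2" by (simp add: r_def power2_eq_square)
  then have "\<bar>poly p (Re z)\<bar> = norm P" by (metis abs_norm_cancel power2_eq_iff abs_minus_cancel)
  then show ?thesis using zs zr P_def by metis
qed

text \<open>In the degenerate case \<open>p\<close> is constant, and any point of the spectrum will do; the
  nondegenerate case, applied to the identity polynomial, shows that there is one.\<close>

lemma norm_poly_bop_attained:
  fixes T :: "'a::complex_hilbert bop"
  assumes T: "hermitian T" and nt: "(1 :: 'a bop) \<noteq> 0"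
  shows "\<exists>x. complex_of_real x \<in> spectrum T \<and> \<bar>poly p x\<bar> = norm (poly_bop p T)"
proof (cases "p * p - [:(norm (poly_bop p T))\<^sup>2:] = 0")
  case True
  have "[:0, 1:] * [:0, 1:] - [:(norm (poly_bop [:0, 1:] T))\<^sup>2:] \<noteq> 0" by simp
  then obtain x where x: "complex_of_real x \<in> spectrum T"
    using norm_poly_bop_attained_nondegenerate[OF T nt] by blast
  have "(poly p x)\<^sup>2 = (norm (poly_bop p T))\<^sup>2"
    using arg_cong[OF True, of "\<lambda>q. poly q x"] by (simp add: power2_eq_square)
  then have "\<bar>poly p x\<bar> = norm (poly_bop p T)"
    by (metis abs_norm_cancel power2_eq_iff abs_minus_cancel)
  with x show ?thesis by blast
qed (rule norm_poly_bop_attained_nondegenerate[OF T nt])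

lemma norm_poly_bop_le:
  fixes T :: "'a::complex_hilbert bop"
  assumes "hermitian T" "0 \<le> K" "\<And>x. complex_of_real x \<in> spectrum T \<Longrightarrow> \<bar>poly p x\<bar> \<le> K"
  shows "norm (poly_bop p T) \<le> K"
proof (cases "(1 :: 'a bop) = 0")
  case True
  then have "poly_bop p T = 0" by (metis mult.right_neutral mult_zero_right)
  with assms show ?thesis by simp
qed (use norm_poly_bop_attained[of T p] assms in metis)

section \<open>The functional calculus of a positive operator\<close>

lemma weierstrass_poly_sequence:
  fixes f :: "real \<Rightarrow> real"
  assumes "continuous_on {a..b} f"
  shows "\<exists>p. uniform_limit {a..b} (\<lambda>n. poly (p n)) f sequentially"
proof -
  have "\<exists>p. \<forall>x\<in>{a..b}. \<bar>f x - poly p x\<bar> < 1 / Suc n" for n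
  proof -
    obtain g where g: "real_polynomial_function g" "\<And>x. x \<in> {a..b} \<Longrightarrow> \<bar>f x - g x\<bar> < 1 / Suc n"
      using Stone_Weierstrass_real_polynomial_function[OF _ assms, of "1 / Suc n"] by auto
    then obtain c m where gs: "g = (\<lambda>x. \<Sum>i\<le>m. c i * x ^ i)"
      using real_polynomial_function_iff_sum by blast
    have "poly (\<Sum>i\<le>m. monom (c i) i) x = g x" for x
      by (simp add: gs poly_sum poly_monom)
    with g(2) show ?thesis by metis
  qed
  then obtain p where p: "\<And>n x. x \<in> {a..b} \<Longrightarrow> \<bar>f x - poly (p n) x\<bar> < 1 / Suc n" by metis
  have "uniform_limit {a..b} (\<lambda>n. poly (p n)) f sequentially"
  proof (rule uniform_limitI)
    fix e :: real assume "0 < e"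
    then have "\<forall>\<^sub>F n in sequentially. 1 / real (Suc n) < e"
      using order_tendstoD(2)[OF LIMSEQ_Suc[OF lim_1_over_n]] by simp
    then show "\<forall>\<^sub>F n in sequentially. \<forall>x\<in>{a..b}. dist (poly (p n) x) (f x) < e"
    proof eventually_elim
      case (elim n)
      then show ?case using less_trans[OF p elim] by (simp add: dist_real_def abs_minus_commute)
    qed
  qed
  then show ?thesis by blast
qed

lemma poly_bop_close:
  assumes "hermitian T" "0 \<le> d" "0 \<le> e"
    and "\<And>x. complex_of_real x \<in> spectrum T \<Longrightarrow> \<bar>poly p x - f x\<bar> \<le> d"
    and "\<And>x. complex_of_real x \<in> spectrum T \<Longrightarrow> \<bar>poly q x - f x\<bar> \<le> e"
  shows "norm (poly_bop p T - poly_bop q T) \<le> d + e"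
proof -
  have "norm (poly_bop (p - q) T) \<le> d + e"
  proof (rule norm_poly_bop_le)
    show "\<bar>poly (p - q) x\<bar> \<le> d + e" if "complex_of_real x \<in> spectrum T" for x
      using assms(4,5)[OF that] by simp
  qed (use assms in auto)
  then show ?thesis by (simp add: poly_bop_diff)
qed

lemma uniform_limit_abs_le:
  fixes f :: "'b \<Rightarrow> real"
  assumes "uniform_limit S g f F" "0 < e"
  shows "\<forall>\<^sub>F n in F. \<forall>x\<in>S. \<bar>g n x - f x\<bar> \<le> e"
  using uniform_limitD[OF assms] by eventually_elim (auto simp: dist_real_def intro: less_imp_le)

text \<open>Justifies the description operator in \<open>cfc\<close>: sequences of polynomials that converge to \<open>f\<close>
  uniformly on the spectrum give Cauchy sequences of operators, and any two of them the same limit.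
  Convergence is assumed on the interval \<open>[0, M]\<close>, so that one sequence serves all positive operators of
  norm at most \<open>M\<close>.\<close>

lemma cfc_LIMSEQ:
  fixes T :: "'a::complex_hilbert bop"
  assumes T: "positive T" "norm T \<le> M"
    and p: "uniform_limit {0..M} (\<lambda>n. poly (p n)) f sequentially"
  shows "(\<lambda>n. poly_bop (p n) T) \<longlonglongrightarrow> cfc f T"
proof -
  let ?s = "{x. complex_of_real x \<in> spectrum T}"
  have h: "hermitian T" using T by (simp add: positive_def)
  have sub: "?s \<subseteq> {0..M}"
    using spectrum_positive(2,3)[OF T(1)] T(2) by fastforce
  have close: "\<exists>N. \<forall>m\<ge>N. \<forall>n\<ge>N. norm (poly_bop (q m) T - poly_bop (r n) T) < e"
    if q: "uniform_limit ?s (\<lambda>n. poly (q n)) f sequentially"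
      and r: "uniform_limit ?s (\<lambda>n. poly (r n)) f sequentially" and e: "0 < e" for q r e
  proof -
    have "\<forall>\<^sub>F n in sequentially. (\<forall>x\<in>?s. \<bar>poly (q n) x - f x\<bar> \<le> e / 3) \<and>
        (\<forall>x\<in>?s. \<bar>poly (r n) x - f x\<bar> \<le> e / 3)"
      using uniform_limit_abs_le[OF q, of "e / 3"] uniform_limit_abs_le[OF r, of "e / 3"] e
      by (auto intro: eventually_conj)
    then obtain N where N: "\<And>n. n \<ge> N \<Longrightarrow> (\<forall>x\<in>?s. \<bar>poly (q n) x - f x\<bar> \<le> e / 3) \<and>
        (\<forall>x\<in>?s. \<bar>poly (r n) x - f x\<bar> \<le> e / 3)"
      unfolding eventually_sequentially by blast
    have "norm (poly_bop (q m) T - poly_bop (r n) T) < e" if "m \<ge> N" "n \<ge> N" for m n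
      using poly_bop_close[OF h, of "e / 3" "e / 3" "q m" f "r n"] N[OF that(1)] N[OF that(2)] e
      by auto
    then show ?thesis by blast
  qed
  have ps: "uniform_limit ?s (\<lambda>n. poly (p n)) f sequentially"
    by (rule uniform_limit_on_subset[OF p sub])
  have "Cauchy (\<lambda>n. poly_bop (p n) T)" by (rule CauchyI) (rule close[OF ps ps])
  then obtain S where S: "(\<lambda>n. poly_bop (p n) T) \<longlonglongrightarrow> S"
    using Cauchy_convergent_iff convergent_def by blast
  have "cfc f T = S" unfolding cfc_def
  proof (rule the_equality)
    show "\<exists>p. uniform_limit ?s (\<lambda>n. poly (p n)) f sequentially \<and> (\<lambda>n. poly_bop (p n) T) \<longlonglongrightarrow> S"
      using ps S by blast
    fix R assume "\<exists>p. uniform_limit ?s (\<lambda>n. poly (p n)) f sequentially \<and> (\<lambda>n. poly_bop (p n) T) \<longlonglongrightarrow> R"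
    then obtain q where q: "uniform_limit ?s (\<lambda>n. poly (q n)) f sequentially"
      and R: "(\<lambda>n. poly_bop (q n) T) \<longlonglongrightarrow> R" by blast
    have "(\<lambda>n. poly_bop (q n) T - poly_bop (p n) T) \<longlonglongrightarrow> 0"
      unfolding LIMSEQ_iff using close[OF q ps] by simp (meson order_refl)
    with tendsto_diff[OF R S] have "R - S = 0" using LIMSEQ_unique by blast
    then show "R = S" by simp
  qed
  with S show ?thesis by simp
qed

lemma cfc_poly_close:
  fixes T :: "'a::complex_hilbert bop"
  assumes T: "positive T" "norm T \<le> M" and f: "continuous_on {0..M} f"
    and e: "0 \<le> e" "\<And>x. x \<in> {0..M} \<Longrightarrow> \<bar>poly p x - f x\<bar> \<le> e"
  shows "norm (poly_bop p T - cfc f T) \<le> e"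
proof (rule field_le_epsilon)
  fix d :: real assume d: "0 < d"
  obtain q where q: "uniform_limit {0..M} (\<lambda>n. poly (q n)) f sequentially"
    using weierstrass_poly_sequence[OF f] by blast
  have h: "hermitian T" using T by (simp add: positive_def)
  have s: "x \<in> {0..M}" if "complex_of_real x \<in> spectrum T" for x
    using spectrum_positive(2,3)[OF T(1) that] T(2) by simp
  have "\<forall>\<^sub>F n in sequentially. norm (poly_bop p T - poly_bop (q n) T) \<le> e + d"
    using uniform_limit_abs_le[OF q d]
    by eventually_elim (use poly_bop_close[OF h e(1), of d p f] e(2) s d in auto)
  moreover have "(\<lambda>n. norm (poly_bop p T - poly_bop (q n) T)) \<longlonglongrightarrow> norm (poly_bop p T - cfc f T)"
    by (intro tendsto_intros cfc_LIMSEQ[OF T q])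
  ultimately show "norm (poly_bop p T - cfc f T) \<le> e + d"
    using tendsto_upperbound by (metis sequentially_bot)
qed

lemma continuous_on_poly_bop:
  fixes Z :: "'b::topological_space \<Rightarrow> 'a::complex_hilbert bop"
  shows "continuous_on S Z \<Longrightarrow> continuous_on S (\<lambda>t. poly_bop p (Z t))"
  unfolding poly_bop_def by (intro continuous_intros)

text \<open>Approximating \<open>f\<close> by a polynomial \<open>p\<close> on \<open>[0, M]\<close> gives an error in \<open>f(Z\<^sub>t)\<close> that is uniform in \<open>t\<close>, and
  \<open>p(Z\<^sub>t)\<close> is continuous in \<open>t\<close>.\<close>

lemma continuous_on_cfc:
  fixes Z :: "'b::topological_space \<Rightarrow> 'a::complex_hilbert bop"
  assumes Z: "continuous_on S Z" "\<And>t. t \<in> S \<Longrightarrow> positive (Z t)" "\<And>t. t \<in> S \<Longrightarrow> norm (Z t) \<le> M"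
    and f: "continuous_on {0..M} f"
  shows "continuous_on S (\<lambda>t. cfc f (Z t))"
proof -
  obtain q where q: "uniform_limit {0..M} (\<lambda>n. poly (q n)) f sequentially"
    using weierstrass_poly_sequence[OF f] by blast
  have "uniform_limit S (\<lambda>n t. poly_bop (q n) (Z t)) (\<lambda>t. cfc f (Z t)) sequentially"
  proof (rule uniform_limitI)
    fix e :: real assume e: "0 < e"
    then have e2: "0 < e / 2" by simp
    show "\<forall>\<^sub>F n in sequentially. \<forall>t\<in>S. dist (poly_bop (q n) (Z t)) (cfc f (Z t)) < e"
      using uniform_limit_abs_le[OF q e2]
    proof eventually_elim
      case (elim n)
      show ?case
      proof
        fix t assume t: "t \<in> S"
        have "norm (poly_bop (q n) (Z t) - cfc f (Z t)) \<le> e / 2"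
          by (rule cfc_poly_close[OF Z(2)[OF t] Z(3)[OF t] f]) (use elim e in auto)
        then show "dist (poly_bop (q n) (Z t)) (cfc f (Z t)) < e" using e by (simp add: dist_norm)
      qed
    qed
  qed
  then show ?thesis
    by (rule uniform_limit_theorem[rotated])
      (auto intro!: always_eventually continuous_on_poly_bop Z(1))
qed

lemma bounded_linear_bop_eval: "bounded_linear (\<lambda>T. bop_apply T x)"
  by (rule bounded_linear_intro[where K = "norm x"])
    (simp_all add: bop_rep_eqs norm_bop_apply)

lemma bounded_linear_bop_form: "bounded_linear (\<lambda>T. inner (bop_apply T x) y)"
  by (rule bounded_linear_compose[OF bounded_linear_inner_left bounded_linear_bop_eval])

lemma hermitian_LIMSEQ:
  assumes "\<And>n. hermitian (X n)" "X \<longlonglongrightarrow> L"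
  shows "hermitian L"
  unfolding hermitian_def
proof (intro allI)
  fix x y
  have "(\<lambda>n. inner (bop_apply (X n) x) y) \<longlonglongrightarrow> inner (bop_apply L x) y"
    by (rule bounded_linear.tendsto[OF bounded_linear_bop_form assms(2)])
  moreover have "inner (bop_apply (X n) x) y = inner (bop_apply (X n) y) x" for n
    using hermitianD[OF assms(1)] inner_commute by metis
  ultimately have "inner (bop_apply L x) y = inner (bop_apply L y) x"
    using LIMSEQ_unique bounded_linear.tendsto[OF bounded_linear_bop_form assms(2), of y x] by auto
  then show "inner (bop_apply L x) y = inner x (bop_apply L y)" by (simp add: inner_commute)
qed

lemma positive_LIMSEQ:
  assumes "\<And>n. positive (X n)" "X \<longlonglongrightarrow> L"
  shows "positive L"
proof -
  have "0 \<le> inner (bop_apply L x) x" for x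
    using assms(1)
    by (intro LIMSEQ_le_const[OF bounded_linear.tendsto[OF bounded_linear_bop_form assms(2)]])
      (auto simp: positive_def)
  then show ?thesis
    using hermitian_LIMSEQ[OF _ assms(2)] assms(1) by (simp add: positive_def)
qed

text \<open>Approximating \<open>sqrt f\<close> instead of \<open>f\<close> exhibits \<open>f(T)\<close> as a limit of squares of Hermitian operators.\<close>

lemma positive_cfc:
  fixes T :: "'a::complex_hilbert bop"
  assumes T: "positive T" and f: "continuous_on {0..norm T} f" "\<And>x. x \<in> {0..norm T} \<Longrightarrow> 0 \<le> f x"
  shows "positive (cfc f T)"
proof -
  let ?I = "{0..norm T}"
  have c: "continuous_on ?I (\<lambda>x. sqrt (f x))" using f(1) by (intro continuous_intros)
  then obtain q where q: "uniform_limit ?I (\<lambda>n. poly (q n)) (\<lambda>x. sqrt (f x)) sequentially"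
    using weierstrass_poly_sequence by blast
  have b: "bounded ((\<lambda>x. sqrt (f x)) ` ?I)"
    by (intro compact_imp_bounded compact_continuous_image c) simp
  have "uniform_limit ?I (\<lambda>n x. poly (q n) x * poly (q n) x) (\<lambda>x. sqrt (f x) * sqrt (f x)) sequentially"
    by (rule uniform_lim_mult[OF q q b b])
  then have "uniform_limit ?I (\<lambda>n. poly (q n * q n)) f sequentially"
    by (rule uniform_limit_cong'[THEN iffD1, rotated 2]) (use f(2) in auto)
  from cfc_LIMSEQ[OF T order_refl this] show ?thesis
  proof (rule positive_LIMSEQ[rotated])
    have "hermitian T" using T by (simp add: positive_def)
    from positive_sq[OF hermitian_poly_bop[OF this]]
    show "positive (poly_bop (q n * q n) T)" for n
      by (simp add: poly_bop_mult power2_eq_square)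
  qed
qed

lemma norm_cfc_le:
  fixes T :: "'a::complex_hilbert bop"
  assumes T: "positive T" and f: "continuous_on {0..norm T} f" 
    and K: "\<And>x. x \<in> {0..norm T} \<Longrightarrow> \<bar>f x\<bar> \<le> K"
  shows "norm (cfc f T) \<le> K"
proof (rule field_le_epsilon)
  fix d :: real assume d: "0 < d"
  obtain q where q: "uniform_limit {0..norm T} (\<lambda>n. poly (q n)) f sequentially"
    using weierstrass_poly_sequence[OF f] by blast
  have h: "hermitian T" using T by (simp add: positive_def)
  have K0: "0 \<le> K" using K[of 0] by simp
  have "\<forall>\<^sub>F n in sequentially. norm (poly_bop (q n) T) \<le> K + d"
    using uniform_limit_abs_le[OF q d]
  proof eventually_elim
    case (elim n)
    show ?case
    proof (rule norm_poly_bop_le[OF h])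
      fix x assume "complex_of_real x \<in> spectrum T"
      then have x: "x \<in> {0..norm T}" using spectrum_positive(2,3)[OF T] by fastforce
      then have "\<bar>poly (q n) x - f x\<bar> \<le> d" using elim by blast
      with K[OF x] show "\<bar>poly (q n) x\<bar> \<le> K + d" by simp
    qed (use K0 d in simp)
  qed
  moreover have "(\<lambda>n. norm (poly_bop (q n) T)) \<longlonglongrightarrow> norm (cfc f T)"
    by (intro tendsto_intros cfc_LIMSEQ[OF T order_refl q])
  ultimately show "norm (cfc f T) \<le> K + d"
    using tendsto_upperbound by (metis sequentially_bot)
qed

section \<open>Midpoint convexity and averages\<close>

text \<open>After subtracting the chord, the function vanishes at 0 and 1. A maximal value \<open>h u\<close> at \<open>u \<le> 1/2\<close>
  satisfies \<open>h u \<le> (h 0 + h (2u))/2 \<le> h u / 2\<close>, so it is not positive; the case \<open>u \<ge> 1/2\<close> is symmetric.\<close>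

lemma midpoint_convex_chord:
  fixes g :: "real \<Rightarrow> real"
  assumes g: "continuous_on {0..1} g"
    and mid: "\<And>s t. s \<in> {0..1} \<Longrightarrow> t \<in> {0..1} \<Longrightarrow> g ((s + t) / 2) \<le> (g s + g t) / 2"
    and t: "t \<in> {0..1}"
  shows "g t \<le> (1 - t) * g 0 + t * g 1"
proof -
  define h where "h t = g t - ((1 - t) * g 0 + t * g 1)" for t
  have hmid: "h ((s + t) / 2) \<le> (h s + h t) / 2" if "s \<in> {0..1}" "t \<in> {0..1}" for s t
    using mid[OF that] by (simp add: h_def field_simps)
  have h01: "h 0 = 0" "h 1 = 0" by (simp_all add: h_def)
  have "continuous_on {0..1} h" unfolding h_def by (intro continuous_intros g)
  then obtain u where u: "u \<in> {0..1}" "\<And>s. s \<in> {0..1} \<Longrightarrow> h s \<le> h u"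
    using continuous_attains_sup[of "{0..1::real}" h] by fastforce
  have "h u \<le> 0"
  proof (cases "u \<le> 1/2")
    case True
    then show ?thesis using hmid[of 0 "2 * u"] u(2)[of "2 * u"] u(1) h01 by simp
  next
    case False
    then show ?thesis using hmid[of "2 * u - 1" 1] u(2)[of "2 * u - 1"] u(1) h01 by simp
  qed
  with u(2)[OF t] show ?thesis by (simp add: h_def)
qed

text \<open>The substitution \<open>t \<mapsto> 1 - t\<close> shows that \<open>g\<close> and \<open>(g t + g (1 - t))/2\<close> have the same integral. The latter is
  at least \<open>g (1/2)\<close> by midpoint convexity and at most \<open>(g 0 + g 1)/2\<close> by the chord estimates at \<open>t\<close> and
  \<open>1 - t\<close>.\<close>

lemma hermite_hadamard:
  fixes g :: "real \<Rightarrow> real"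
  assumes g: "continuous_on {0..1} g"
    and mid: "\<And>s t. s \<in> {0..1} \<Longrightarrow> t \<in> {0..1} \<Longrightarrow> g ((s + t) / 2) \<le> (g s + g t) / 2"
  shows "g (1/2) \<le> integral {0..1} g" "integral {0..1} g \<le> (g 0 + g 1) / 2"
proof -
  have i: "(g has_integral integral {0..1} g) {0..1}"
    using g by (simp add: integrable_continuous_real integrable_integral)
  have "(\<lambda>x::real. 1 - x) ` {0..1} = {0..1}"
    by (auto simp: image_iff intro!: bexI[of _ "1 - _"])
  then have "((\<lambda>t. g (1 - t)) has_integral integral {0..1} g) {0..1}"
    using has_integral_affinity[of g "integral {0..1} g" 0 1 "-1" 1] i by simp
  from has_integral_mult_right[OF has_integral_add[OF i this], of "1/2"]
  have s: "((\<lambda>t. (g t + g (1 - t)) / 2) has_integral integral {0..1} g) {0..1}" by simp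
  have c: "((\<lambda>t::real. c) has_integral c) {0..1}" for c :: real
    using has_integral_const_real[of c 0 1] by simp
  show "g (1/2) \<le> integral {0..1} g"
    by (rule has_integral_le[OF c s]) (use mid[of _ "1 - _"] in force)
  show "integral {0..1} g \<le> (g 0 + g 1) / 2"
  proof (rule has_integral_le[OF s c])
    fix t :: real assume "t \<in> {0..1}"
    then show "(g t + g (1 - t)) / 2 \<le> (g 0 + g 1) / 2"
      using midpoint_convex_chord[OF assms, of t] midpoint_convex_chord[OF assms, of "1 - t"]
      by (simp add: algebra_simps)
  qed
qed

section \<open>The numerical radius and the Cartesian decomposition\<close>

text \<open>Used for the real and imaginary parts \<open>S\<close> of \<open>T\<close>. The squares matter on the zero space, where
  the numerical radius is the supremum of the empty set, an unspecified real number.\<close>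

lemma hermitian_norm_le_numerical_radius:
  fixes S T :: "'a::complex_hilbert bop"
  assumes S: "hermitian S"
    and le: "\<And>x. \<bar>inner (bop_apply S x) x\<bar> \<le> cmod (cinner (bop_apply T x) x)"
  shows "(norm S)\<^sup>2 \<le> (numerical_radius T)\<^sup>2"
proof (cases "\<exists>x::'a. x \<noteq> 0")
  case False
  then have "S = 0" by (intro bop_eqI) metis
  then show ?thesis by simp
next
  case True
  have cs: "cmod (cinner (bop_apply T x) x) \<le> 2 * norm T" if "norm x = 1" for x
  proof -
    have "\<bar>inner u x\<bar> \<le> norm T" if "norm u = norm (bop_apply T x)" for u
      using Cauchy_Schwarz_ineq2[of u x] norm_bop_apply[of T x] \<open>norm x = 1\<close> that by simp
    from this[of "bop_apply T x"] this[of "\<i> *\<^sub>C bop_apply T x"]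
    show ?thesis using cmod_le[of "cinner (bop_apply T x) x"]
      by (simp add: Im_cinner norm_scaleC inner_eq_Re_cinner[symmetric])
  qed
  have w: "cmod (cinner (bop_apply T x) x) \<le> numerical_radius T" if "norm x = 1" for x
    unfolding numerical_radius_def
    by (rule cSUP_upper) (use that cs in \<open>auto simp: bdd_above_def\<close>)
  obtain x0 :: 'a where "x0 \<noteq> 0" using True by blast
  then have "norm (x0 /\<^sub>R norm x0) = 1" by simp
  from w[OF this] have w0: "0 \<le> numerical_radius T" using norm_ge_zero order_trans by blast
  have "norm S \<le> numerical_radius T"
  proof (rule hermitian_norm_le[OF S w0])
    fix x
    show "\<bar>inner (bop_apply S x) x\<bar> \<le> numerical_radius T * (norm x)\<^sup>2"
    proof (cases "x = 0")
      case False
      define u where "u = x /\<^sub>R norm x"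
      have u: "norm u = 1" "x = norm x *\<^sub>R u" using False by (simp_all add: u_def)
      have "inner (bop_apply S x) x = (norm x)\<^sup>2 * inner (bop_apply S u) u"
        by (subst (1 2) u(2)) (simp add: bop_apply_linear power2_eq_square)
      moreover have "\<bar>inner (bop_apply S u) u\<bar> \<le> numerical_radius T"
        using le[of u] w[OF u(1)] by linarith
      ultimately show ?thesis by (simp add: abs_mult mult.commute mult_right_mono)
    qed (simp add: bop_apply_linear)
  qed
  then show ?thesis by (simp add: power_mono)
qed

lemma inner_ii_left: "inner (\<i> *\<^sub>C x) y = - inner x (\<i> *\<^sub>C y)" for x y :: "'a::complex_inner"
proof -
  have "inner (\<i> *\<^sub>C x) y = - Im (cinner x y)" by (simp add: Im_cinner)
  also have "\<dots> = Im (cinner y x)" using arg_cong[OF cinner_commute[of x y], of Im] by simp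
  also have "\<dots> = - inner x (\<i> *\<^sub>C y)" by (simp add: Im_cinner inner_commute)
  finally show ?thesis .
qed

lemma adj_cartesian:
  assumes "hermitian B" "hermitian C"
  shows "adj (B + \<i> *\<^sub>C C) = B - \<i> *\<^sub>C C"
proof (rule adj_eqI)
  show "inner (bop_apply (B + \<i> *\<^sub>C C) x) y = inner x (bop_apply (B - \<i> *\<^sub>C C) y)" for x y
    by (simp add: bop_rep_eqs inner_add inner_diff inner_ii_left hermitianD[OF assms(1)]
        hermitianD[OF assms(2)] bop_apply_linear)
qed

lemma cartesian_square_sum:
  fixes B C :: "'a::complex_hilbert bop"
  shows "(B - \<i> *\<^sub>C C) * (B + \<i> *\<^sub>C C) + (B + \<i> *\<^sub>C C) * (B - \<i> *\<^sub>C C) = 2 *\<^sub>R (B\<^sup>2 + C\<^sup>2)"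
  by (simp add: algebra_simps bop_scaleC_mult scaleC_scaleC scaleC_minus_left scaleC_one
      scaleC_add_right scaleC_diff_right power2_eq_square scaleR_2)

lemma cinner_cartesian:
  assumes "hermitian B" "hermitian C"
  shows "Re (cinner (bop_apply (B + \<i> *\<^sub>C C) x) x) = inner (bop_apply B x) x"
    "Im (cinner (bop_apply (B + \<i> *\<^sub>C C) x) x) = inner (bop_apply C x) x"
proof -
  have z: "inner (\<i> *\<^sub>C bop_apply S x) x = 0" if "hermitian S" for S
  proof -
    have "inner (\<i> *\<^sub>C bop_apply S x) x = - inner x (\<i> *\<^sub>C bop_apply S x)"
      by (simp add: inner_ii_left hermitianD[OF that] bop_apply_linear)
    then show ?thesis by (simp add: inner_commute)
  qed
  show "Re (cinner (bop_apply (B + \<i> *\<^sub>C C) x) x) = inner (bop_apply B x) x"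
    by (simp add: inner_eq_Re_cinner[symmetric] bop_rep_eqs inner_add z assms)
  show "Im (cinner (bop_apply (B + \<i> *\<^sub>C C) x) x) = inner (bop_apply C x) x"
    by (simp add: Im_cinner bop_rep_eqs scaleC_add_right scaleC_scaleC inner_add inner_diff z assms
        scaleC_minus_left scaleC_one)
qed

section \<open>The inequality\<close>

lemma norm_cfc_sq_le:
  fixes B :: "'a::complex_hilbert bop"
  assumes B: "hermitian B" "(norm B)\<^sup>2 \<le> r"
    and f: "continuous_on {0..} f" "mono_on {0..} f" "\<And>x. 0 \<le> x \<Longrightarrow> 0 \<le> f x"
  shows "norm (cfc f (B\<^sup>2)) \<le> f r"
proof (rule norm_cfc_le[OF positive_sq[OF B(1)]])
  show "continuous_on {0..norm (B\<^sup>2)} f" by (rule continuous_on_subset[OF f(1)]) auto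
  fix x assume x: "x \<in> {0..norm (B\<^sup>2)}"
  have "norm (B\<^sup>2) \<le> (norm B)\<^sup>2" by (simp add: power2_eq_square norm_mult_ineq)
  then have "x \<le> r" using x B(2) by simp
  then have "f x \<le> f r" using x by (intro mono_onD[OF f(2)]) auto
  then show "\<bar>f x\<bar> \<le> f r" using f(3)[of x] x by simp
qed

text \<open>Operator convexity, read off on quadratic forms. The spectral conditions in its definition hold because a
  positive operator has nonnegative spectrum.\<close>

lemma operator_convex_on_form:
  fixes X Y :: "'a::complex_hilbert bop"
  assumes "operator_convex_on TYPE('a) {0..} f" "positive X" "positive Y"
  shows "inner (bop_apply (cfc f ((1/2) *\<^sub>R (X + Y))) x) x
    \<le> (inner (bop_apply (cfc f X) x) x + inner (bop_apply (cfc f Y) x) x) / 2"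
proof -
  have s: "spectrum Z \<subseteq> complex_of_real ` {0..}" if "positive Z" for Z :: "'a bop"
    using spectrum_positive(1,2)[OF that] by (metis atLeast_iff image_eqI subsetI)
  have "cfc f ((1/2) *\<^sub>R (X + Y)) \<preceq> (1/2) *\<^sub>R (cfc f X + cfc f Y)"
    using assms s unfolding operator_convex_on_def selfadjoint_iff_hermitian
    by (simp add: positive_def)
  then show ?thesis
    unfolding psd_le_def complex_nonneg_Reals_iff inner_eq_Re_cinner[symmetric]
    by (simp add: bop_rep_eqs inner_diff inner_add field_simps)
qed

lemma norm_cfc_hermite_hadamard:
  fixes X Y :: "'a::complex_hilbert bop"
  assumes f: "operator_convex_on TYPE('a) {0..} f" "\<And>x. 0 \<le> x \<Longrightarrow> 0 \<le> f x"
    and X: "positive X" and Y: "positive Y"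
  shows "norm (cfc f ((1/2) *\<^sub>R (X + Y)))
      \<le> norm (integral {0..1} (\<lambda>t. cfc f ((1 - t) *\<^sub>R X + t *\<^sub>R Y)))"
    "norm (integral {0..1} (\<lambda>t. cfc f ((1 - t) *\<^sub>R X + t *\<^sub>R Y)))
      \<le> 1/2 * norm (cfc f X + cfc f Y)"
proof -
  define Z where "Z t = (1 - t) *\<^sub>R X + t *\<^sub>R Y" for t :: real
  define F where "F t = cfc f (Z t)" for t
  define I where "I = integral {0..1} F"
  have fc: "continuous_on {0..M} f" for M
    using f(1) by (auto simp: operator_convex_on_def intro: continuous_on_subset)
  have Zp: "positive (Z t)" if "t \<in> {0..1}" for t
    unfolding Z_def using that by (intro positive_add positive_scaleR X Y) auto
  have Zn: "norm (Z t) \<le> norm X + norm Y" if "t \<in> {0..1}" for t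
  proof -
    have "norm (Z t) \<le> (1 - t) * norm X + t * norm Y"
      unfolding Z_def using that norm_triangle_ineq[of "(1 - t) *\<^sub>R X" "t *\<^sub>R Y"] by simp
    also have "\<dots> \<le> 1 * norm X + 1 * norm Y"
      using that by (intro add_mono mult_right_mono) auto
    finally show ?thesis by simp
  qed
  have pos: "positive (cfc f T)" if "positive T" for T :: "'a bop"
    using that fc f(2) by (intro positive_cfc) auto
  have Fc: "continuous_on {0..1} F" unfolding F_def
    by (rule continuous_on_cfc[OF _ Zp Zn fc]) (auto simp: Z_def intro!: continuous_intros)
  have FI: "(F has_integral I) {0..1}" unfolding I_def
    using Fc by (simp add: integrable_continuous_real integrable_integral)
  have form: "((\<lambda>t. inner (bop_apply (F t) x) y) has_integral inner (bop_apply I x) y) {0..1}" for x y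
    using has_integral_linear[OF FI bounded_linear_bop_form[of x y]] by (simp add: o_def)
  have Fp: "positive (F t)" if "t \<in> {0..1}" for t
    unfolding F_def by (rule pos[OF Zp[OF that]])
  have Ip: "positive I"
    unfolding positive_def hermitian_def
  proof (intro conjI allI)
    fix x y
    have "((\<lambda>t. inner (bop_apply (F t) y) x) has_integral inner (bop_apply I x) y) {0..1}"
      by (rule has_integral_eq[OF _ form])
        (use Fp in \<open>simp add: positive_def hermitian_def inner_commute\<close>)
    from has_integral_unique[OF this form] show "inner (bop_apply I x) y = inner x (bop_apply I y)"
      by (simp add: inner_commute)
    show "0 \<le> inner (bop_apply I x) x"
      by (rule has_integral_nonneg[OF form]) (use Fp in \<open>simp add: positive_def\<close>)
  qed
  have hh: "inner (bop_apply (F (1/2)) x) x \<le> inner (bop_apply I x) x"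
    "inner (bop_apply I x) x \<le> (inner (bop_apply (F 0) x) x + inner (bop_apply (F 1) x) x) / 2" for x
  proof -
    define g where "g t = inner (bop_apply (F t) x) x" for t
    have gc: "continuous_on {0..1} g" unfolding g_def
      by (rule bounded_linear.continuous_on[OF bounded_linear_bop_form Fc])
    have mid: "g ((s + t) / 2) \<le> (g s + g t) / 2" if "s \<in> {0..1}" "t \<in> {0..1}" for s t
    proof -
      have "Z ((s + t) / 2) = (1/2) *\<^sub>R (Z s + Z t)"
        by (simp add: Z_def algebra_simps flip: scaleR_add_left)
      then show ?thesis
        using operator_convex_on_form[OF f(1) Zp[OF that(1)] Zp[OF that(2)]] by (simp add: g_def F_def)
    qed
    have ig: "integral {0..1} g = inner (bop_apply I x) x"
      unfolding g_def by (rule integral_unique[OF form])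
    show "inner (bop_apply (F (1/2)) x) x \<le> inner (bop_apply I x) x"
      "inner (bop_apply I x) x \<le> (inner (bop_apply (F 0) x) x + inner (bop_apply (F 1) x) x) / 2"
      using hermite_hadamard[OF gc mid] unfolding ig by (simp_all add: g_def)
  qed
  have Fe: "F = (\<lambda>t. cfc f ((1 - t) *\<^sub>R X + t *\<^sub>R Y))"
    by (simp add: fun_eq_iff F_def Z_def)
  have Fs: "F (1/2) = cfc f ((1/2) *\<^sub>R (X + Y))" "F 0 = cfc f X" "F 1 = cfc f Y"
    by (simp_all add: F_def Z_def scaleR_add_right)
  have "norm (F (1/2)) \<le> norm I" by (rule norm_mono_positive[OF Fp hh(1)]) simp
  then show "norm (cfc f ((1/2) *\<^sub>R (X + Y)))
      \<le> norm (integral {0..1} (\<lambda>t. cfc f ((1 - t) *\<^sub>R X + t *\<^sub>R Y)))"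
    unfolding Fs I_def unfolding Fe by simp
  have "norm I \<le> norm ((1/2) *\<^sub>R (F 0 + F 1))"
    by (rule norm_mono_positive[OF Ip]) (use hh(2) in \<open>simp add: bop_rep_eqs inner_add\<close>)
  then show "norm (integral {0..1} (\<lambda>t. cfc f ((1 - t) *\<^sub>R X + t *\<^sub>R Y)))
      \<le> 1/2 * norm (cfc f X + cfc f Y)"
    unfolding Fs I_def unfolding Fe by simp
qed

theorem theorem2p2:
  fixes A B C :: "'a::complex_hilbert bop" and f :: "real \<Rightarrow> real"
  assumes cartesian: "A = B + \<i> *\<^sub>C C" "selfadjoint B" "selfadjoint C"
    and nonneg: "\<And>x. x \<ge> 0 \<Longrightarrow> f x \<ge> 0"
    and increasing: "mono_on {0..} f"
    and op_convex: "operator_convex_on TYPE('a) {0..} f"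
  shows "norm (cfc f ((1/4) *\<^sub>R (adj A * A + A * adj A)))
           \<le> norm (integral {0..1} (\<lambda>t::real. cfc f ((1 - t) *\<^sub>R B\<^sup>2 + t *\<^sub>R C\<^sup>2)))
       \<and> norm (integral {0..1} (\<lambda>t::real. cfc f ((1 - t) *\<^sub>R B\<^sup>2 + t *\<^sub>R C\<^sup>2)))
           \<le> 1/2 * norm (cfc f (B\<^sup>2) + cfc f (C\<^sup>2))
       \<and> 1/2 * norm (cfc f (B\<^sup>2) + cfc f (C\<^sup>2))
           \<le> f ((numerical_radius A)\<^sup>2)"
proof -
  have B: "hermitian B" and C: "hermitian C"
    using cartesian(2,3) by (simp_all add: selfadjoint_iff_hermitian)
  have sq: "(1/4) *\<^sub>R (adj A * A + A * adj A) = (1/2) *\<^sub>R (B\<^sup>2 + C\<^sup>2)"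
    unfolding cartesian(1) adj_cartesian[OF B C] cartesian_square_sum by simp
  have wB: "(norm B)\<^sup>2 \<le> (numerical_radius A)\<^sup>2"
    by (rule hermitian_norm_le_numerical_radius[OF B])
      (metis abs_Re_le_cmod cinner_cartesian(1)[OF B C] cartesian(1))
  have wC: "(norm C)\<^sup>2 \<le> (numerical_radius A)\<^sup>2"
    by (rule hermitian_norm_le_numerical_radius[OF C])
      (metis abs_Im_le_cmod cinner_cartesian(2)[OF B C] cartesian(1))
  have fc: "continuous_on {0..} f" using op_convex by (simp add: operator_convex_on_def)
  have "norm (cfc f (B\<^sup>2) + cfc f (C\<^sup>2)) \<le> norm (cfc f (B\<^sup>2)) + norm (cfc f (C\<^sup>2))"
    by (rule norm_triangle_ineq)
  also have "\<dots> \<le> 2 * f ((numerical_radius A)\<^sup>2)"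
    using norm_cfc_sq_le[OF B wB fc increasing nonneg] norm_cfc_sq_le[OF C wC fc increasing nonneg]
    by simp
  finally show ?thesis
    using norm_cfc_hermite_hadamard[OF op_convex nonneg positive_sq[OF B] positive_sq[OF C]]
    unfolding sq by simp
qed

end
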